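(* For every $k\geq 0$, the polynomial $H_k(x)$ is unimodal, i.e. its sequence of coefficients is unimodal.
   Context: $B_n(y)=\sum_{\pi\in B_n}y^{\mathrm{des}_B(\pi)}$ is the type $B$ Eulerian polynomial: $B_n$ is the set of signed permutations $\pi_1\cdots\pi_n$ of $[n]$, and with $\pi_0=0$, $\mathrm{des}_B(\pi)$ counts $i\in\{0,\dots,n-1\}$ with $\pi_i>\pi_{i+1}$; $B_0=1$. Define \[H_k(x)=\sum_{l=0}^{k}B_{k-l}(x^{2k+2})(x^{2k+2}-1)^l\sum_{s=l}^{k}\binom{s}{l}x^{2k+1-s}+\sum_{l=0}^{k}B_{k-l}(x^{-2k-2})(x^{-2k-2}-1)^l\sum_{s=l}^{k}\binom{s}{l}x^{2(k+1)^2+s}.\] A sequence $s_1,\dots,s_m$ is unimodal if there is $t$ with $s_1\le\cdots\le s_t\ge s_{t+1}\ge\cdots\ge s_m$. *)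

theory Defs
  imports "HOL-Computational_Algebra.Computational_Algebra"
begin

(* Signed permutations of [n]: pi : nat => int with pi i = 0 outside {1..n}
   (so in particular pi 0 = 0, matching the convention pi_0 = 0),
   and i |-> |pi i| a bijection of {1..n}. *)
definition signed_perms :: "nat \<Rightarrow> (nat \<Rightarrow> int) set" where
  "signed_perms n = {\<pi>. (\<forall>i. i \<notin> {1..n} \<longrightarrow> \<pi> i = 0) \<and>
                          bij_betw (\<lambda>i. nat \<bar>\<pi> i\<bar>) {1..n} {1..n}}"

definition desB :: "nat \<Rightarrow> (nat \<Rightarrow> int) \<Rightarrow> nat" where
  "desB n \<pi> = card {i \<in> {0..<n}. \<pi> i > \<pi> (Suc i)}"

(* B_n(x^e) as a formal Laurent series in x, i.e. sum over pi of (x^e)^(des_B pi) *)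
definition BEuler_at :: "nat \<Rightarrow> int \<Rightarrow> int fls" where
  "BEuler_at n e = (\<Sum>\<pi>\<in>signed_perms n. fls_X_intpow (e * int (desB n \<pi>)))"

definition H :: "nat \<Rightarrow> int fls" where
  "H k = (\<Sum>l=0..k. BEuler_at (k - l) (2*int k + 2) * (fls_X_intpow (2*int k + 2) - 1) ^ l *
            (\<Sum>s=l..k. of_nat (s choose l) * fls_X_intpow (2*int k + 1 - int s)))
       + (\<Sum>l=0..k. BEuler_at (k - l) (-2*int k - 2) * (fls_X_intpow (-2*int k - 2) - 1) ^ l *
            (\<Sum>s=l..k. of_nat (s choose l) * fls_X_intpow (2*(int k + 1)^2 + int s)))"

definition unimodal :: "'a::order list \<Rightarrow> bool" where
  "unimodal xs \<longleftrightarrow> (\<exists>t. (\<forall>i j. i \<le> j \<longrightarrow> j \<le> t \<longrightarrow> j < length xs \<longrightarrow> xs ! i \<le> xs ! j) \<and>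
                         (\<forall>i j. t \<le> i \<longrightarrow> i \<le> j \<longrightarrow> j < length xs \<longrightarrow> xs ! j \<le> xs ! i))"

definition coeff_seq :: "'a::zero poly \<Rightarrow> 'a list" where
  "coeff_seq p = map (coeff p) [0..<Suc (degree p)]"

end

theory Submission
  imports Defs
begin

text \<open>The insertion recurrence for \<open>B\<^sub>n\<close> gives
  \<open>B\<^sub>n(y) / (1 - y)\<^sup>n\<^sup>+\<^sup>1 = \<Sum>\<^sub>m (2m + 1)\<^sup>n y\<^sup>m\<close>, and therefore
  \<open>H\<^sub>k(x) = x\<^sup>N (1 - x\<^sup>2\<^sup>N)\<^sup>N \<Sum>\<^sub>n x\<^sup>N\<^sup>n \<Sum>\<^sub>s n\<^sup>k\<^sup>-\<^sup>s (n + 1)\<^sup>s x\<^sup>s\<close>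
  with \<open>N = k + 1\<close> and \<open>0 \<le> s \<le> k\<close>. Since \<open>n\<^sup>k\<^sup>-\<^sup>s (n + 1)\<^sup>s\<^sup>+\<^sup>1 - n\<^sup>k\<^sup>+\<^sup>1\<^sup>-\<^sup>s (n + 1)\<^sup>s = n\<^sup>k\<^sup>-\<^sup>s (n + 1)\<^sup>s\<close>,
  the coefficients for \<open>k + 1\<close> are the sums of \<open>2N\<close> consecutive coefficients for \<open>k\<close>, with
  every \<open>N\<close>-th of them repeated. Sliding window sums and repetitions preserve
  unimodality of nonnegative sequences, so induction on \<open>k\<close> applies.\<close>

section \<open>Signed permutations and their descents\<close>

lemma signed_perms_iff:
  "\<pi> \<in> signed_perms n \<longleftrightarrow>
     (\<forall>i. i \<notin> {1..n} \<longrightarrow> \<pi> i = 0) \<and> (\<forall>i\<in>{1..n}. \<pi> i \<noteq> 0 \<and> \<bar>\<pi> i\<bar> \<le> int n) \<and>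
     (\<forall>i\<in>{1..n}. \<forall>j\<in>{1..n}. \<bar>\<pi> i\<bar> = \<bar>\<pi> j\<bar> \<longrightarrow> i = j)"
proof -
  have "bij_betw (\<lambda>i. nat \<bar>\<pi> i\<bar>) {1..n} {1..n} \<longleftrightarrow>
      inj_on (\<lambda>i. nat \<bar>\<pi> i\<bar>) {1..n} \<and> (\<lambda>i. nat \<bar>\<pi> i\<bar>) ` {1..n} \<subseteq> {1..n}"
    using endo_inj_surj [of "{1..n}" "\<lambda>i. nat \<bar>\<pi> i\<bar>"] by (auto simp: bij_betw_def)
  also have "inj_on (\<lambda>i. nat \<bar>\<pi> i\<bar>) {1..n} \<longleftrightarrow>
      (\<forall>i\<in>{1..n}. \<forall>j\<in>{1..n}. \<bar>\<pi> i\<bar> = \<bar>\<pi> j\<bar> \<longrightarrow> i = j)"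
    by (auto simp: inj_on_def nat_eq_iff2)
  also have "(\<lambda>i. nat \<bar>\<pi> i\<bar>) ` {1..n} \<subseteq> {1..n} \<longleftrightarrow> (\<forall>i\<in>{1..n}. \<pi> i \<noteq> 0 \<and> \<bar>\<pi> i\<bar> \<le> int n)"
    by (force simp: image_subset_iff nat_le_iff Suc_le_eq)
  finally show ?thesis
    unfolding signed_perms_def by blast
qed

lemma signed_perms_zero: "\<pi> \<in> signed_perms n \<Longrightarrow> j \<notin> {1..n} \<Longrightarrow> \<pi> j = 0"
  unfolding signed_perms_iff by blast

lemma signed_perms_nonzero: "\<pi> \<in> signed_perms n \<Longrightarrow> j \<in> {1..n} \<Longrightarrow> \<pi> j \<noteq> 0"
  unfolding signed_perms_iff by blast

lemma signed_perms_inj: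
  "\<pi> \<in> signed_perms n \<Longrightarrow> i \<in> {1..n} \<Longrightarrow> j \<in> {1..n} \<Longrightarrow> \<bar>\<pi> i\<bar> = \<bar>\<pi> j\<bar> \<Longrightarrow> i = j"
  unfolding signed_perms_iff by blast

lemma signed_perms_abs_le:
  assumes "\<pi> \<in> signed_perms n"
  shows "\<bar>\<pi> j\<bar> \<le> int n"
proof (cases "j \<in> {1..n}")
  case True
  with assms show ?thesis unfolding signed_perms_iff by blast
next
  case False
  with assms show ?thesis by (simp add: signed_perms_zero)
qed

lemma signed_perms_0: "signed_perms 0 = {\<lambda>_. 0}"
  by (auto simp: signed_perms_def bij_betw_def)

lemma desB_sum: "desB n \<pi> = (\<Sum>i<n. of_bool (\<pi> i > \<pi> (Suc i)))"
proof -
  have "{i \<in> {0..<n}. \<pi> i > \<pi> (Suc i)} = {..<n} \<inter> {i. \<pi> i > \<pi> (Suc i)}"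
    by auto
  then show ?thesis
    by (simp add: desB_def sum_of_bool_eq flip: of_nat_id)
qed

lemma signed_perms_neq_Suc:
  assumes "\<pi> \<in> signed_perms n" "i < n"
  shows "\<pi> i \<noteq> \<pi> (Suc i)"
proof (cases "i = 0")
  case True
  with assms have "\<pi> i = 0" "\<pi> (Suc i) \<noteq> 0"
    using signed_perms_zero [of \<pi> n 0] signed_perms_nonzero [of \<pi> n "Suc 0"] by auto
  then show ?thesis by simp
next
  case False
  with assms signed_perms_inj [of \<pi> n i "Suc i"] show ?thesis by auto
qed

lemma uminus_in_signed_perms: "\<pi> \<in> signed_perms n \<Longrightarrow> (\<lambda>i. - \<pi> i) \<in> signed_perms n"
  by (simp add: signed_perms_def)

text \<open>Neighbours always differ and \<open>0\<close> at position \<open>0\<close> is fixed by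
  negation, so negation swaps ascents and descents. This yields both the palindromicity of
  \<open>Bpoly\<close> and the bound \<open>desB n \<pi> \<le> n\<close>.\<close>

lemma desB_uminus:
  assumes "\<pi> \<in> signed_perms n"
  shows "desB n (\<lambda>i. - \<pi> i) + desB n \<pi> = n"
proof -
  have "desB n (\<lambda>i. - \<pi> i) + desB n \<pi> = (\<Sum>i<n. 1)"
    unfolding desB_sum sum.distrib [symmetric]
    using signed_perms_neq_Suc [OF assms] by (intro sum.cong refl) force
  then show ?thesis by simp
qed

section \<open>Inserting the letter of largest absolute value\<close>

text \<open>The index \<open>i\<close> names a gap: gap \<open>0\<close> comes right after the
  conventional leading zero, and for words of length \<open>n\<close> gap \<open>n\<close> is the
  end.\<close>

definition insert_letter :: "(nat \<Rightarrow> int) \<Rightarrow> nat \<Rightarrow> int \<Rightarrow> nat \<Rightarrow> int" where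
  "insert_letter \<pi> i a j = (if j \<le> i then \<pi> j else if j = Suc i then a else \<pi> (j - 1))"

lemma insert_letter_in_signed_perms:
  assumes p: "\<pi> \<in> signed_perms n" and i: "i \<le> n" and a: "\<bar>a\<bar> = int (Suc n)"
  shows "insert_letter \<pi> i a \<in> signed_perms (Suc n)"
proof -
  define \<tau> where "\<tau> = insert_letter \<pi> i a"
  define r where "r j = (if j \<le> i then j else j - 1)" for j :: nat
  have \<tau>: "\<tau> j = (if j = Suc i then a else \<pi> (r j))" for j
    by (simp add: \<tau>_def insert_letter_def r_def)
  have r_in: "r j \<in> {1..n}" if "j \<in> {1..Suc n}" "j \<noteq> Suc i" for j
    using that i by (auto simp: r_def)
  have r_inj: "j = j'" if "r j = r j'" "j \<noteq> Suc i" "j' \<noteq> Suc i" for j j'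
    using that by (auto simp: r_def split: if_splits)
  note zero = signed_perms_zero [OF p] and nz = signed_perms_nonzero [OF p] signed_perms_abs_le [OF p]
    and inj = signed_perms_inj [OF p]
  have "\<tau> j = 0" if "j \<notin> {1..Suc n}" for j
    using that i by (auto simp: \<tau> r_def intro!: zero)
  moreover have "\<tau> j \<noteq> 0 \<and> \<bar>\<tau> j\<bar> \<le> int (Suc n)" if "j \<in> {1..Suc n}" for j
    using nz(1) [OF r_in [OF that]] nz(2) [of "r j"] a by (auto simp: \<tau>)
  moreover have "j = j'" if "j \<in> {1..Suc n}" "j' \<in> {1..Suc n}" "\<bar>\<tau> j\<bar> = \<bar>\<tau> j'\<bar>" for j j'
  proof (cases "j = Suc i \<or> j' = Suc i")
    case True
    moreover have "\<bar>\<tau> m\<bar> = int (Suc n) \<longleftrightarrow> m = Suc i" for m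
      using nz(2) [of "r m"] a by (simp add: \<tau>)
    ultimately show ?thesis
      using that by metis
  next
    case False
    then show ?thesis
      using that by (intro r_inj [OF inj [OF r_in r_in]]) (auto simp: \<tau>)
  qed
  ultimately show ?thesis
    unfolding \<tau>_def [symmetric] signed_perms_iff by blast
qed

text \<open>The inverse deletes the unique letter of absolute value \<open>n + 1\<close>. Its
  position and sign can be read off because all other letters are at most \<open>n\<close> in
  absolute value.\<close>

lemma bij_betw_insert_letter:
  "bij_betw (\<lambda>(\<pi>, i, a). insert_letter \<pi> i a)
     (signed_perms n \<times> {..n} \<times> {int (Suc n), - int (Suc n)}) (signed_perms (Suc n))"
  unfolding bij_betw_def
proof
  let ?D = "signed_perms n \<times> {..n} \<times> {int (Suc n), - int (Suc n)}"
  show "inj_on (\<lambda>(\<pi>, i, a). insert_letter \<pi> i a) ?D"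
  proof (rule inj_onI)
    fix x y assume "x \<in> ?D" "y \<in> ?D"
      and "(\<lambda>(\<pi>, i, a). insert_letter \<pi> i a) x = (\<lambda>(\<pi>, i, a). insert_letter \<pi> i a) y"
    then obtain \<pi> \<pi>' i i' a a' where xy: "x = (\<pi>, i, a)" "y = (\<pi>', i', a')"
      and p: "\<pi> \<in> signed_perms n" "\<pi>' \<in> signed_perms n"
      and a: "a \<in> {int (Suc n), - int (Suc n)}" "a' \<in> {int (Suc n), - int (Suc n)}"
      and eq: "insert_letter \<pi> i a = insert_letter \<pi>' i' a'"
      by (cases x; cases y) simp
    have small: "\<bar>\<pi> j\<bar> \<le> int n" "\<bar>\<pi>' j\<bar> \<le> int n" for j
      using p by (simp_all add: signed_perms_abs_le)
    have a_big: "\<bar>a\<bar> = int (Suc n)" "\<bar>a'\<bar> = int (Suc n)"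
      using a by auto
    have "insert_letter \<pi> i a (Suc i) = a"
      by (simp add: insert_letter_def)
    then have "insert_letter \<pi>' i' a' (Suc i) = a"
      by (simp add: eq)
    moreover have "\<pi>' (Suc i) \<noteq> a" "\<pi>' i \<noteq> a"
      using small(2) [of "Suc i"] small(2) [of i] a_big(1) by linarith+
    ultimately have ii: "i = i'"
      by (simp add: insert_letter_def split: if_splits)
    then have aa: "a = a'"
      using fun_cong [OF eq, of "Suc i"] by (simp add: insert_letter_def)
    have "\<pi> j = \<pi>' j" for j
      using fun_cong [OF eq, of j] fun_cong [OF eq, of "Suc j"] ii
      by (cases "j \<le> i") (simp_all add: insert_letter_def)
    then show "x = y"
      using ii aa xy by blast
  qed
  show "(\<lambda>(\<pi>, i, a). insert_letter \<pi> i a) ` ?D = signed_perms (Suc n)"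
  proof (intro equalityI subsetI)
    fix \<tau> assume "\<tau> \<in> (\<lambda>(\<pi>, i, a). insert_letter \<pi> i a) ` ?D"
    then show "\<tau> \<in> signed_perms (Suc n)"
      using insert_letter_in_signed_perms [of _ n _ "int (Suc n)"]
        insert_letter_in_signed_perms [of _ n _ "- int (Suc n)"] by auto
  next
    fix \<tau> assume t: "\<tau> \<in> signed_perms (Suc n)"
    then have "Suc n \<in> (\<lambda>i. nat \<bar>\<tau> i\<bar>) ` {1..Suc n}"
      by (simp add: signed_perms_def bij_betw_def)
    then obtain q where q': "q \<in> {1..Suc n}" "Suc n = nat \<bar>\<tau> q\<bar>"
      by (rule imageE)
    then have "\<bar>\<tau> q\<bar> = int (Suc n)"
      by linarith
    note q = q'(1) this
    define i where "i = q - 1"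
    have i: "i \<le> n" "q = Suc i" using q by (auto simp: i_def)
    define \<pi> where "\<pi> j = \<tau> (if j \<le> i then j else Suc j)" for j
    note zero = signed_perms_zero [OF t] and nz = signed_perms_nonzero [OF t] signed_perms_abs_le [OF t]
    and inj = signed_perms_inj [OF t]
    have r_in: "(if j \<le> i then j else Suc j) \<in> {1..Suc n}" if "j \<in> {1..n}" for j
      using that by (simp add: le_SucI)
    have "\<pi> j = 0" if "j \<notin> {1..n}" for j
      using that i by (auto simp: \<pi>_def intro!: zero)
    moreover have "\<pi> j \<noteq> 0 \<and> \<bar>\<pi> j\<bar> \<le> int n" if "j \<in> {1..n}" for j
    proof -
      have "\<bar>\<pi> j\<bar> \<noteq> \<bar>\<tau> q\<bar>"
        using inj [OF r_in [OF that] q(1)] i unfolding \<pi>_def by (auto split: if_splits)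
      then show ?thesis
        using nz(1) [OF r_in [OF that]] nz(2) [of "if j \<le> i then j else Suc j"] q unfolding \<pi>_def by linarith
    qed
    moreover have "j = j'" if "j \<in> {1..n}" "j' \<in> {1..n}" "\<bar>\<pi> j\<bar> = \<bar>\<pi> j'\<bar>" for j j'
      using inj [OF r_in [OF that(1)] r_in [OF that(2)]] that(3)
      unfolding \<pi>_def by (auto split: if_splits)
    ultimately have "\<pi> \<in> signed_perms n"
      unfolding signed_perms_iff by blast
    moreover have "\<tau> = insert_letter \<pi> i (\<tau> q)"
      using i by (auto simp: fun_eq_iff insert_letter_def \<pi>_def)
    moreover have "\<tau> q \<in> {int (Suc n), - int (Suc n)}" using q by auto
    ultimately show "\<tau> \<in> (\<lambda>(\<pi>, i, a). insert_letter \<pi> i a) ` ?D"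
      using i by (intro image_eqI [of _ _ "(\<pi>, i, \<tau> q)"]) auto
  qed
qed

text \<open>At the end there is no right neighbour to compensate, so here the sign of the new letter
  matters.\<close>

lemma desB_insert_letter_last:
  assumes p: "\<pi> \<in> signed_perms n" and a: "\<bar>a\<bar> = int (Suc n)"
  shows "desB (Suc n) (insert_letter \<pi> n a) = desB n \<pi> + of_bool (a < 0)"
proof -
  have "\<bar>\<pi> n\<bar> \<le> int n"
    using p by (rule signed_perms_abs_le)
  then have "(\<pi> n > a) = (a < 0)" using a by linarith
  then show ?thesis
    by (simp add: desB_sum insert_letter_def)
qed

text \<open>A letter that is larger in absolute value than all the others creates exactly one descent
  between its two neighbours, whatever its sign.\<close>

lemma desB_insert_letter:
  assumes p: "\<pi> \<in> signed_perms n" and i: "i < n" and a: "\<bar>a\<bar> = int (Suc n)"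
  shows "desB (Suc n) (insert_letter \<pi> i a) = (if \<pi> i > \<pi> (Suc i) then desB n \<pi> else Suc (desB n \<pi>))"
proof -
  let ?d = "\<lambda>\<tau> j. of_bool (\<tau> j > \<tau> (Suc j)) :: nat"
  let ?\<tau> = "insert_letter \<pi> i a"
  obtain m where m: "n = Suc (i + m)" using i less_imp_Suc_add by blast
  \<comment> \<open>Insertion replaces the one adjacency at \<open>i\<close> by two, keeps those
    before it and shifts those after it by one.\<close>
  have split: "(\<Sum>j<Suc (i + m). f j) = (\<Sum>j<i. f j) + f i + (\<Sum>j<m. f (Suc (i + j)))"
    for f :: "nat \<Rightarrow> nat" and m
    by (induction m) auto
  have small: "\<bar>\<pi> j\<bar> \<le> int n" for j
    using p by (rule signed_perms_abs_le)
  have neq: "\<pi> i \<noteq> \<pi> (Suc i)" using signed_perms_neq_Suc [OF p i] .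
  have "desB (Suc n) ?\<tau> = (\<Sum>j<i. ?d ?\<tau> j) + ?d ?\<tau> i + ?d ?\<tau> (Suc i)
      + (\<Sum>j<m. ?d ?\<tau> (Suc (Suc (i + j))))"
    using split [of "?d ?\<tau>" "Suc m"] unfolding m desB_sum
    by (subst (asm) (2) sum.lessThan_Suc_shift) simp
  also have "(\<Sum>j<i. ?d ?\<tau> j) = (\<Sum>j<i. ?d \<pi> j)"
    by (intro sum.cong refl) (simp add: insert_letter_def)
  also have "(\<Sum>j<m. ?d ?\<tau> (Suc (Suc (i + j)))) = (\<Sum>j<m. ?d \<pi> (Suc (i + j)))"
    by (intro sum.cong refl) (simp add: insert_letter_def)
  also have "?d ?\<tau> i = of_bool (a < 0)"
  proof -
    have "(\<pi> i > a) = (a < 0)" using small [of i] a by linarith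
    then show ?thesis by (simp add: insert_letter_def)
  qed
  also have "?d ?\<tau> (Suc i) = of_bool (\<not> a < 0)"
  proof -
    have "(a > \<pi> (Suc i)) = (\<not> a < 0)" using small [of "Suc i"] a by linarith
    then show ?thesis by (simp add: insert_letter_def)
  qed
  also have "(\<Sum>j<i. ?d \<pi> j) + of_bool (a < 0) + of_bool (\<not> a < 0) + (\<Sum>j<m. ?d \<pi> (Suc (i + j)))
      = (\<Sum>j<i. ?d \<pi> j) + (\<Sum>j<m. ?d \<pi> (Suc (i + j))) + 1"
    by simp
  finally show ?thesis
    using split [of "?d \<pi>" m] unfolding m desB_sum by auto
qed

section \<open>Recurrence and generating series of the type B Eulerian polynomials\<close>

lemma pderiv_sum: "pderiv (sum f A) = (\<Sum>x\<in>A. pderiv (f x))"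
  by (induction A rule: infinite_finite_induct) (simp_all add: pderiv_add)

definition Bpoly :: "nat \<Rightarrow> int poly" where
  "Bpoly n = (\<Sum>\<pi>\<in>signed_perms n. monom 1 (desB n \<pi>))"

lemma Bpoly_0: "Bpoly 0 = 1"
  by (simp add: Bpoly_def signed_perms_0 desB_def)

text \<open>A permutation with \<open>d\<close> descents has \<open>d\<close> gaps contributing
  \<open>2 y^d\<close> each, \<open>n - d\<close> gaps contributing \<open>2 y^(d+1)\<close> each,
  and the last gap contributing \<open>y^d + y^(d+1)\<close>. The factors \<open>d\<close> in the
  total are produced by the derivative.\<close>

lemma Bpoly_Suc:
  "Bpoly (Suc n) = [:1, 2 * int n + 1:] * Bpoly n + [:0, 2, -2:] * pderiv (Bpoly n)"
proof -
  let ?L = "{int (Suc n), - int (Suc n)}"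
  have one: "(\<Sum>i\<le>n. \<Sum>a\<in>?L. monom 1 (desB (Suc n) (insert_letter \<pi> i a)))
     = [:1, 2 * int n + 1:] * monom 1 (desB n \<pi>) + [:0, 2, -2:] * pderiv (monom 1 (desB n \<pi>))"
    if p: "\<pi> \<in> signed_perms n" for \<pi>
  proof -
    define d where "d = desB n \<pi>"
    let ?P = "\<lambda>i. \<pi> i > \<pi> (Suc i)"
    have "(\<Sum>i<n. \<Sum>a\<in>?L. monom (1::int) (desB (Suc n) (insert_letter \<pi> i a)))
      = (\<Sum>i<n. (if ?P i then monom 2 d else monom 2 (Suc d)))"
      using p by (intro sum.cong refl) (auto simp: desB_insert_letter d_def add_monom)
    also have "\<dots> = of_nat (card ({..<n} \<inter> Collect ?P)) * monom 2 d
        + of_nat (card ({..<n} \<inter> - Collect ?P)) * monom 2 (Suc d)"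
      by (simp add: sum.If_cases)
    also have "card ({..<n} \<inter> Collect ?P) = d"
      unfolding d_def desB_def by (rule arg_cong [of _ _ card]) auto
    also have "card ({..<n} \<inter> - Collect ?P) = n - d"
    proof -
      have "{..<n} \<inter> - Collect ?P = {..<n} - ({..<n} \<inter> Collect ?P)" by auto
      then show ?thesis
        using \<open>card ({..<n} \<inter> Collect ?P) = d\<close> by (simp add: card_Diff_subset)
    qed
    finally have inner: "(\<Sum>i<n. \<Sum>a\<in>?L. monom (1::int) (desB (Suc n) (insert_letter \<pi> i a)))
      = of_nat d * monom 2 d + of_nat (n - d) * monom 2 (Suc d)" .
    have last: "(\<Sum>a\<in>?L. monom (1::int) (desB (Suc n) (insert_letter \<pi> n a))) = monom 1 d + monom 1 (Suc d)"
      using p by (simp add: desB_insert_letter_last d_def)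
    have dn: "d \<le> n" using desB_uminus [OF p] by (simp add: d_def)
    have "(\<Sum>i\<le>n. \<Sum>a\<in>?L. monom (1::int) (desB (Suc n) (insert_letter \<pi> i a)))
       = of_nat d * monom 2 d + of_nat (n - d) * monom 2 (Suc d) + (monom 1 d + monom 1 (Suc d))"
      using inner last by (simp add: lessThan_Suc_atMost [symmetric])
    also have "\<dots> = monom (2 * int d + 1) d + monom (2 * int (n - d) + 1) (Suc d)"
      by (simp add: of_nat_poly smult_monom add_monom [symmetric] mult.commute)
    also have "\<dots> = [:1, 2 * int n + 1:] * monom 1 d + [:0, 2, -2:] * pderiv (monom 1 d)"
    proof -
      have lin: "[:1, 2 * int n + 1:] = monom 1 0 + monom (2 * int n + 1) 1"
        and quad: "[:0, 2, -2::int:] = monom 2 1 + monom (-2) 2"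
        by (simp_all add: monom_Suc monom_0 eval_nat_numeral)
      show ?thesis
        unfolding lin quad using dn by (cases d)
          (simp_all add: pderiv_monom distrib_right mult_monom add_monom poly_eq_iff of_nat_diff)
    qed
    finally show ?thesis unfolding d_def .
  qed
  have "Bpoly (Suc n) = (\<Sum>(\<pi>, i, a)\<in>signed_perms n \<times> {..n} \<times> ?L.
      monom 1 (desB (Suc n) (insert_letter \<pi> i a)))"
    unfolding Bpoly_def
    by (subst sum.reindex_bij_betw [OF bij_betw_insert_letter, symmetric]) (simp add: case_prod_unfold)
  also have "\<dots> = (\<Sum>\<pi>\<in>signed_perms n. \<Sum>i\<le>n. \<Sum>a\<in>?L. monom 1 (desB (Suc n) (insert_letter \<pi> i a)))"
    by (simp add: sum.cartesian_product [symmetric])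
  also have "\<dots> = (\<Sum>\<pi>\<in>signed_perms n. [:1, 2 * int n + 1:] * monom 1 (desB n \<pi>)
      + [:0, 2, -2:] * pderiv (monom 1 (desB n \<pi>)))"
    by (intro sum.cong refl one)
  also have "\<dots> = [:1, 2 * int n + 1:] * Bpoly n + [:0, 2, -2:] * pderiv (Bpoly n)"
    unfolding Bpoly_def by (simp only: sum.distrib sum_distrib_left pderiv_sum)
  finally show ?thesis .
qed

text \<open>Multiplying the \<open>m\<close>-th coefficient by \<open>2m + 1\<close> is the operator
  \<open>1 + 2 y d/dy\<close>; applied to \<open>B_n / (1 - y)^(n+1)\<close> it reproduces the
  recurrence of \<open>Bpoly_Suc\<close>.\<close>

lemma fps_of_Bpoly:
  "fps_of_poly (Bpoly n) = (1 - fps_X) ^ Suc n * Abs_fps (\<lambda>m. (2 * int m + 1) ^ n)"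
proof (induction n)
  case 0
  have "Abs_fps (\<lambda>m. (2 * int m + 1) ^ 0) = Abs_fps (\<lambda>_. 1)" by simp
  moreover have "(1 - fps_X) * Abs_fps (\<lambda>_. 1::int) = 1"
    by (simp add: fps_eq_iff left_diff_distrib)
  ultimately show ?case by (simp add: Bpoly_0)
next
  case (Suc n)
  define S where "S = Abs_fps (\<lambda>m. (2 * int m + 1) ^ n)"
  let ?Y = "1 - fps_X :: int fps"
  have S': "Abs_fps (\<lambda>m. (2 * int m + 1) ^ Suc n) = S + 2 * fps_X * fps_deriv S"
  proof (rule fps_ext)
    fix m
    show "Abs_fps (\<lambda>m. (2 * int m + 1) ^ Suc n) $ m = (S + 2 * fps_X * fps_deriv S) $ m"
      by (cases m) (simp_all add: S_def mult.assoc numeral_fps_const algebra_simps)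
  qed
  have lin: "fps_of_poly [:1, 2 * int n + 1:] = 1 + (2 * of_nat n + 1) * fps_X"
  proof (rule fps_ext)
    fix m
    have "(2 * of_nat n + 1 :: int fps) = fps_const (2 * int n + 1)"
      by (simp add: numeral_fps_const fps_of_nat flip: fps_const_add fps_const_mult)
    then show "fps_of_poly [:1, 2 * int n + 1:] $ m = (1 + (2 * of_nat n + 1) * fps_X) $ m"
      by (cases m) (auto simp: coeff_pCons fps_X_def split: nat.splits)
  qed
  have quad: "fps_of_poly [:0, 2, -2::int:] = 2 * fps_X * ?Y"
  proof -
    have "[:0, 2, -2::int:] = [:2:] * [:0, 1:] * (1 - [:0, 1:])"
      by (simp add: one_pCons)
    then show ?thesis
      by (simp only: fps_of_poly_mult fps_of_poly_diff fps_of_poly_fps_X fps_of_poly_numeral' fps_of_poly_1)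
  qed
  have "fps_of_poly (Bpoly (Suc n)) = (1 + (2 * of_nat n + 1) * fps_X) * (?Y ^ Suc n * S)
      + 2 * fps_X * ?Y * fps_deriv (?Y ^ Suc n * S)"
    unfolding Bpoly_Suc fps_of_poly_add fps_of_poly_mult lin quad fps_of_poly_pderiv Suc S_def ..
  also have "fps_deriv (?Y ^ Suc n * S) = ?Y ^ Suc n * fps_deriv S - (of_nat n + 1) * ?Y ^ n * S"
  proof -
    have "fps_deriv (?Y ^ Suc n) = - ((of_nat n + 1) * ?Y ^ n)"
      by (subst fps_deriv_power) (simp add: fps_of_nat algebra_simps flip: fps_const_add)
    then show ?thesis by (simp only: fps_deriv_mult) simp
  qed
  also have "(1 + (2 * of_nat n + 1) * fps_X) * (?Y ^ Suc n * S)
      + 2 * fps_X * ?Y * (?Y ^ Suc n * fps_deriv S - (of_nat n + 1) * ?Y ^ n * S)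
      = ?Y ^ Suc (Suc n) * (S + 2 * fps_X * fps_deriv S)"
    unfolding power_Suc by algebra
  finally show ?case unfolding S' .
qed

section \<open>Substitution of monomials into polynomials\<close>

lemma pcompose_monom_1: "pcompose (monom 1 n) q = q ^ n" for q :: "'a :: comm_semiring_1 poly"
  by (induction n) (simp_all add: monom_Suc pcompose_pCons pcompose_1)

lemma pcompose_power: "pcompose (p ^ n) q = pcompose p q ^ n" for q :: "'a :: comm_semiring_1 poly"
  by (induction n) (simp_all add: pcompose_mult pcompose_1)

lemma pcompose_of_nat: "pcompose (of_nat n) q = of_nat n" for q :: "'a :: comm_semiring_1 poly"
  by (simp add: of_nat_poly)

lemma coeff_pcompose_monom:
  fixes p :: "'a :: comm_semiring_1 poly"
  assumes "N > 0"
  shows "coeff (pcompose p (monom 1 N)) n = (if N dvd n then coeff p (n div N) else 0)"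
proof (induction p arbitrary: n)
  case 0
  show ?case by simp
next
  case (pCons a p)
  consider "n = 0" | "0 < n" "n < N" | m where "n = N + m"
    using le_Suc_ex not_less by blast
  then show ?case
  proof cases
    case 1
    then show ?thesis using assms by (simp add: pcompose_pCons coeff_monom_mult)
  next
    case 2
    then have "\<not> N dvd n" by (auto dest: dvd_imp_le)
    with 2 show ?thesis by (simp add: pcompose_pCons coeff_monom_mult coeff_pCons split: nat.split)
  next
    case 3
    then show ?thesis using assms
      by (simp add: pcompose_pCons coeff_monom_mult coeff_pCons pCons.IH split: nat.split)
  qed
qed

section \<open>Binomial combinations of Eulerian polynomials and the slices built from them\<close>

text \<open>This is what multiplies a power of \<open>x\<close> with fixed \<open>s\<close> in
  \<open>H\<close> once the sums over \<open>l\<close> and \<open>s\<close> are swapped. For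
  \<open>c = e (1 - y)\<close> and \<open>s \<le> k\<close> it is the numerator over
  \<open>(1 - y)^(k+1)\<close> of the series with coefficients
  \<open>(2m+1)^(k-s) (2m+1+e)^s\<close>.\<close>

definition B_twist :: "int poly \<Rightarrow> nat \<Rightarrow> nat \<Rightarrow> int poly" where
  "B_twist c k s = (\<Sum>l\<le>k. of_nat (s choose l) * Bpoly (k - l) * c ^ l)"

lemma B_twist_0_right: "B_twist c k 0 = Bpoly k"
  by (simp add: B_twist_def sum.atMost_shift)

text \<open>Pascal's rule for \<open>Suc s choose l\<close>.\<close>

lemma B_twist_Suc: "B_twist c (Suc k) (Suc s) = B_twist c (Suc k) s + c * B_twist c k s"
  unfolding B_twist_def
  by (simp add: sum.atMost_Suc_shift sum.distrib sum_distrib_left algebra_simps del: sum.atMost_Suc)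

text \<open>Each factor of \<open>c = e (1 - y)\<close> supplies a power of \<open>1 - y\<close>
  missing from the numerator \<open>B_(k-l)\<close>, so all terms share \<open>(1 - y)^(k+1)\<close>
  and the binomial theorem sums the rest.\<close>

lemma fps_of_B_twist_diagonal:
  "fps_of_poly (B_twist [:e, -e:] k k) = (1 - fps_X) ^ Suc k * Abs_fps (\<lambda>m. (2 * int m + 1 + e) ^ k)"
proof -
  let ?Y = "1 - fps_X :: int fps"
  let ?S = "\<lambda>n. Abs_fps (\<lambda>m. (2 * int m + 1) ^ n)"
  have e: "fps_of_poly [:e, -e:] = fps_const e * ?Y"
    by (simp add: fps_of_poly_pCons fps_of_poly_const algebra_simps flip: fps_const_neg)
  have "fps_of_poly (B_twist [:e, -e:] k k)
      = (\<Sum>l\<le>k. of_nat (k choose l) * (?Y ^ Suc (k - l) * ?S (k - l)) * (fps_const e * ?Y) ^ l)"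
    by (simp only: B_twist_def fps_of_poly_sum fps_of_poly_mult fps_of_poly_power e fps_of_Bpoly
        of_nat_poly fps_of_poly_const fps_of_nat)
  also have "\<dots> = (\<Sum>l\<le>k. ?Y ^ Suc k * (fps_const (of_nat (k choose l) * e ^ l) * ?S (k - l)))"
  proof (intro sum.cong refl)
    fix l assume "l \<in> {..k}"
    then have "?Y ^ Suc k = ?Y ^ Suc (k - l) * ?Y ^ l"
      by (simp flip: power_add power_Suc)
    then show "of_nat (k choose l) * (?Y ^ Suc (k - l) * ?S (k - l)) * (fps_const e * ?Y) ^ l
        = ?Y ^ Suc k * (fps_const (of_nat (k choose l) * e ^ l) * ?S (k - l))"
      by (simp only: power_mult_distrib fps_const_power fps_const_mult [symmetric] fps_of_nat mult_ac)
  qed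
  also have "\<dots> = ?Y ^ Suc k * (\<Sum>l\<le>k. fps_const (of_nat (k choose l) * e ^ l) * ?S (k - l))"
    by (simp only: sum_distrib_left)
  also have "(\<Sum>l\<le>k. fps_const (of_nat (k choose l) * e ^ l) * ?S (k - l))
      = Abs_fps (\<lambda>m. (2 * int m + 1 + e) ^ k)"
  proof (rule fps_ext)
    fix m
    have "(2 * int m + 1 + e) ^ k = (e + (2 * int m + 1)) ^ k"
      by (simp add: add.commute)
    then show "(\<Sum>l\<le>k. fps_const (of_nat (k choose l) * e ^ l) * ?S (k - l)) $ m
        = Abs_fps (\<lambda>m. (2 * int m + 1 + e) ^ k) $ m"
      by (simp add: fps_sum_nth binomial_ring)
  qed
  finally show ?thesis .
qed

text \<open>Fails for exponent \<open>0\<close>: the two sides are \<open>1\<close> and \<open>y\<close>.\<close>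

lemma B_twist_diagonal_reciprocity: "B_twist [:-1, 1:] (Suc k) (Suc k) = [:0, 1:] * B_twist [:1, -1:] (Suc k) (Suc k)"
proof -
  \<comment> \<open>The choices \<open>e = -1\<close> and \<open>e = 1\<close> give the same
    sequence of powers of even numbers up to a shift, whose new initial term
    \<open>0 ^ Suc k\<close> vanishes.\<close>
  have "Abs_fps (\<lambda>m. (2 * int m) ^ Suc k) = fps_X * Abs_fps (\<lambda>m. (2 * int m + 2) ^ Suc k)"
    (is "?l = fps_X * ?r")
  proof (rule fps_ext)
    fix m show "?l $ m = (fps_X * ?r) $ m"
    proof (cases m)
      case (Suc n)
      have "(2 * int (Suc n)) ^ Suc k = (2 * int n + 2) ^ Suc k"
        by (rule arg_cong [of _ _ "\<lambda>x. x ^ Suc k"]) simp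
      then show ?thesis by (simp add: Suc del: power_Suc of_nat_Suc)
    qed simp
  qed
  then have "fps_of_poly (B_twist [:-1, 1:] (Suc k) (Suc k)) = fps_X * fps_of_poly (B_twist [:1, -1:] (Suc k) (Suc k))"
    using fps_of_B_twist_diagonal [of "-1" "Suc k"] fps_of_B_twist_diagonal [of 1 "Suc k"]
    by (simp add: mult_ac add_ac del: power_Suc)
  then show ?thesis
    unfolding fps_of_poly_eq_iff [symmetric] by (simp only: fps_of_poly_mult fps_of_poly_fps_X)
qed

text \<open>\<open>slice k s\<close> is \<open>(1 - y\<^sup>2)\<^sup>k\<^sup>+\<^sup>1 \<Sum>\<^sub>n n\<^sup>k\<^sup>-\<^sup>s (n + 1)\<^sup>s y\<^sup>n\<close>: the even \<open>n\<close> come from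
  the first sum in \<open>H\<^sub>k\<close>, the odd ones from the second.\<close>

definition slice :: "nat \<Rightarrow> nat \<Rightarrow> int poly" where
  "slice k s = pcompose (B_twist [:-1, 1:] k (k - s)) (monom 1 2) + monom 1 1 * pcompose (B_twist [:1, -1:] k s) (monom 1 2)"

lemma slice_0_0: "slice 0 0 = 1 + monom 1 1"
  by (simp add: slice_def B_twist_def Bpoly_0 pcompose_1)

text \<open>Pascal's rule runs downwards in the even half (index \<open>k - s\<close>) and upwards
  in the odd half (index \<open>s\<close>). The opposite signs of the two twists make both
  increments equal to \<open>1 - y^2\<close> times the old half.\<close>

lemma slice_Suc:
  assumes "s \<le> k"
  shows "slice (Suc k) (Suc s) = slice (Suc k) s + (1 - monom 1 2) * slice k s"
proof -
  have lin: "pcompose [:-1, 1:] (monom (1::int) 2) = monom 1 2 - 1" "pcompose [:1, -1:] (monom (1::int) 2) = 1 - monom 1 2"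
    by (simp_all add: pcompose_pCons one_pCons)
  have "B_twist [:-1, 1:] (Suc k) (Suc k - s) = B_twist [:-1, 1:] (Suc k) (Suc k - Suc s) + [:-1, 1:] * B_twist [:-1, 1:] k (k - s)"
    using B_twist_Suc [of _ k "k - s"] assms by (simp add: Suc_diff_le)
  then show ?thesis
    unfolding slice_def B_twist_Suc by (simp add: pcompose_add pcompose_mult lin algebra_simps del: mult_pCons_left mult_pCons_right)
qed

text \<open>Shifting \<open>n\<close> by one carries \<open>(n + 1)^(k+1)\<close> to
  \<open>n^(k+1)\<close>: one half matches through \<open>B_twist_diagonal_reciprocity\<close>, the
  other is \<open>Bpoly (Suc k)\<close> at \<open>y^2\<close> on both sides.\<close>

lemma slice_Suc_0: "slice (Suc k) 0 = monom 1 1 * slice (Suc k) (Suc k)"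
proof -
  have "pcompose [:0, 1:] (monom (1::int) 2) = monom 1 1 * monom 1 1"
    by (simp add: pcompose_pCons mult_monom numeral_2_eq_2)
  then show ?thesis
    by (simp add: slice_def B_twist_diagonal_reciprocity B_twist_0_right pcompose_mult algebra_simps del: mult_pCons_left)
qed

section \<open>Interleaved slice coefficients as sliding window sums\<close>

text \<open>Index \<open>(k + 1) n + s\<close> holds the \<open>n\<close>-th coefficient of slice
  \<open>s\<close>; by \<open>coeff_H_poly\<close> this is the coefficient sequence of
  \<open>H_poly k\<close> without its \<open>k + 1\<close> leading zeros.\<close>

definition slice_coeff :: "nat \<Rightarrow> nat \<Rightarrow> int" where
  "slice_coeff k j = coeff (slice k (j mod Suc k)) (j div Suc k)"

lemma slice_coeff_eq_coeff: "s \<le> k \<Longrightarrow> slice_coeff k (Suc k * n + s) = coeff (slice k s) n"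
  by (simp add: slice_coeff_def del: mult_Suc)

text \<open>The window ends just before \<open>w\<close>; truncated subtraction makes entries before
  index \<open>0\<close> count as zero.\<close>

definition window :: "(nat \<Rightarrow> int) \<Rightarrow> nat \<Rightarrow> nat \<Rightarrow> int" where
  "window f L w = sum f {w - L..<w}"

lemma window_Suc: "window f L (Suc w) = window f L w + f w - (if L \<le> w then f (w - L) else 0)"
proof (cases "L \<le> w")
  case True
  have "window f L w + f w = sum f {w - L..w}"
    by (simp add: window_def flip: atLeastLessThanSuc_atLeastAtMost)
  also have "\<dots> = f (w - L) + sum f {Suc (w - L)..w}"
    by (rule sum.atLeast_Suc_atMost) simp
  finally show ?thesis
    using True by (simp add: window_def Suc_diff_le atLeastLessThanSuc_atLeastAtMost)
next
  case False
  then show ?thesis by (simp add: window_def not_le Suc_leI)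
qed

text \<open>Inside a block of \<open>k + 2\<close> entries, \<open>slice_Suc\<close> gives
  increments \<open>f w - f (w - 2 (k + 1))\<close>, those of the window. From block to block,
  \<open>slice_Suc_0\<close> equates the last entry with the next first one, and both have window
  index \<open>(k + 1) (n + 1)\<close>.\<close>

lemma slice_coeff_Suc_eq_window:
  assumes "s \<le> Suc k"
  shows "slice_coeff (Suc k) (Suc (Suc k) * n + s) = window (slice_coeff k) (2 * Suc k) (Suc k * n + s)"
  using assms
proof (induction n arbitrary: s)
  have step: "slice_coeff (Suc k) (Suc (Suc k) * n + Suc s) - slice_coeff (Suc k) (Suc (Suc k) * n + s)
      = window (slice_coeff k) (2 * Suc k) (Suc k * n + Suc s) - window (slice_coeff k) (2 * Suc k) (Suc k * n + s)"
    if "s \<le> k" for n s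
  proof -
    have "slice_coeff (Suc k) (Suc (Suc k) * n + Suc s) - slice_coeff (Suc k) (Suc (Suc k) * n + s) = coeff ((1 - monom 1 2) * slice k s) n"
      using that by (simp add: slice_coeff_eq_coeff slice_Suc del: mult_Suc add_Suc_right)
    also have "\<dots> = coeff (slice k s) n - (if 2 \<le> n then coeff (slice k s) (n - 2) else 0)"
      by (simp add: left_diff_distrib coeff_monom_mult)
    also have "\<dots> = slice_coeff k (Suc k * n + s) - (if 2 * Suc k \<le> Suc k * n + s then slice_coeff k (Suc k * n + s - 2 * Suc k) else 0)"
    proof (cases "2 \<le> n")
      case True
      then obtain m where m: "n = 2 + m" using le_Suc_ex by blast
      have e: "Suc k * n + s - 2 * Suc k = Suc k * (n - 2) + s"
        by (simp add: m algebra_simps)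
      moreover have "2 * Suc k \<le> Suc k * n + s"
        by (simp add: m algebra_simps)
      ultimately show ?thesis
        unfolding e slice_coeff_eq_coeff [OF that] using True by simp
    next
      case False
      \<comment> \<open>For \<open>n \<le> 1\<close> nothing has left the window yet, matching the
        absent coefficient \<open>n - 2\<close>.\<close>
      then have "Suc k * n \<le> Suc k * 1" by (intro mult_le_mono) auto
      then have "Suc k * n + s < 2 * Suc k" using that by simp
      then show ?thesis
        using that False by (simp add: slice_coeff_eq_coeff del: mult_Suc)
    qed
    finally show ?thesis
      by (simp add: window_Suc del: mult_Suc)
  qed
  have row: "slice_coeff (Suc k) (Suc (Suc k) * n + s) = window (slice_coeff k) (2 * Suc k) (Suc k * n + s)"
    if "s \<le> Suc k" "slice_coeff (Suc k) (Suc (Suc k) * n) = window (slice_coeff k) (2 * Suc k) (Suc k * n)" for n s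
    using that(1)
  proof (induction s)
    case 0
    then show ?case using that(2) by simp
  next
    case (Suc s)
    then show ?case using step [of s n] by simp
  qed
  {
    case 0
    have "slice_coeff (Suc k) 0 = 0"
      using slice_coeff_eq_coeff [of 0 "Suc k" 0] by (simp add: slice_Suc_0 coeff_monom_mult)
    then show ?case
      using row [of s 0] 0 by (simp add: window_def)
  next
    case (Suc n)
    have "slice_coeff (Suc k) (Suc (Suc k) * Suc n) = coeff (slice (Suc k) 0) (Suc n)"
      using slice_coeff_eq_coeff [of 0 "Suc k" "Suc n"] by simp
    also have "\<dots> = coeff (slice (Suc k) (Suc k)) n"
      by (simp add: slice_Suc_0 coeff_monom_mult)
    also have "\<dots> = slice_coeff (Suc k) (Suc (Suc k) * n + Suc k)"
      by (rule slice_coeff_eq_coeff [symmetric]) simp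
    also have "\<dots> = window (slice_coeff k) (2 * Suc k) (Suc k * n + Suc k)"
      by (rule Suc.IH) simp
    finally have "slice_coeff (Suc k) (Suc (Suc k) * Suc n) = window (slice_coeff k) (2 * Suc k) (Suc k * Suc n)"
      by (simp add: algebra_simps)
    then show ?case by (rule row [OF Suc.prems])
  }
qed

section \<open>Unimodality of infinite sequences\<close>

definition peak_at :: "(nat \<Rightarrow> int) \<Rightarrow> nat \<Rightarrow> bool" where
  "peak_at f t \<longleftrightarrow> (\<forall>i j. i \<le> j \<longrightarrow> j \<le> t \<longrightarrow> f i \<le> f j) \<and> (\<forall>i j. t \<le> i \<longrightarrow> i \<le> j \<longrightarrow> f j \<le> f i)"

lemma peak_atI:
  assumes up: "\<And>i. i < t \<Longrightarrow> f i \<le> f (Suc i)" and down: "\<And>i. t \<le> i \<Longrightarrow> f (Suc i) \<le> f i"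
  shows "peak_at f t"
proof -
  have "f i \<le> f j" if "i \<le> j" "j \<le> t" for i j
    using that by (induction j rule: dec_induct) (auto intro: order_trans [OF _ up])
  moreover have "f j \<le> f i" if "i \<le> j" "t \<le> i" for i j
    using that by (induction j rule: dec_induct) (auto intro: order_trans [OF down])
  ultimately show ?thesis by (auto simp: peak_at_def)
qed

text \<open>Since \<open>r\<close> is monotone and hits the peak, it keeps indices on their side of
  it. This covers repetition of entries.\<close>

lemma peak_at_mono_compose:
  assumes "peak_at f t" "mono r" "r t' = t"
  shows "peak_at (\<lambda>j. f (r j)) t'"
  using assms unfolding peak_at_def by (metis monoD)

lemma window_peak:
  assumes f: "peak_at f t" and nonneg: "\<And>i. f i \<ge> 0"
  shows "\<exists>t'. peak_at (window f L) t'"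
proof -
  have up: "f i \<le> f j" if "i \<le> j" "j \<le> t" for i j using f that by (auto simp: peak_at_def)
  have down: "f j \<le> f i" if "t \<le> i" "i \<le> j" for i j using f that by (auto simp: peak_at_def)
  \<comment> \<open>Beyond the peak of \<open>f\<close>, once an increment \<open>D\<close> of the window sums is nonpositive,
     all later ones are.\<close>
  define D where "D w = f w - (if L \<le> w then f (w - L) else 0)" for w
  have W: "window f L (Suc w) = window f L w + D w" for w
    by (simp add: window_Suc D_def)
  define P where "P w \<longleftrightarrow> t \<le> w \<and> D w \<le> 0" for w
  \<comment> \<open>At \<open>t + L\<close> both the entering and the leaving entry lie at or beyond
    the peak.\<close>
  have ex: "P (t + L)"
    using down [of t "t + L"] by (simp add: P_def D_def)
  define t' where "t' = (LEAST w. P w)"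
  have Pt': "P t'" unfolding t'_def using ex by (rule LeastI)
  have "D w \<ge> 0" if "w < t'" for w
  proof (cases "w < t")
    case True
    then show ?thesis using up [of "w - L" w] nonneg [of w] by (simp add: D_def)
  next
    case False
    then show ?thesis using not_less_Least [of w P] that by (auto simp: t'_def P_def)
  qed
  moreover have "P w" if "t' \<le> w" for w
    using that
  proof (induction w rule: dec_induct)
    case base
    show ?case by (rule Pt')
  next
    case (step w)
    then have w: "t \<le> w" "D w \<le> 0" by (auto simp: P_def)
    have "f (Suc w) \<le> f w" using w by (intro down) auto
    \<comment> \<open>The entry leaving the window is absent, on the falling side, or still rising.
      In the last case the entering entry falls while the leaving one grows, so \<open>D\<close>
      cannot increase.\<close>
    consider "w < L" | "L \<le> w" "t \<le> w - L" | "L \<le> w" "w - L < t" by linarith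
    then have "D (Suc w) \<le> 0"
    proof cases
      case 1
      then show ?thesis using w \<open>f (Suc w) \<le> f w\<close> nonneg [of "Suc w - L"] by (simp add: D_def)
    next
      case 2
      then have "f (Suc w) \<le> f (Suc w - L)" by (intro down) auto
      then show ?thesis using 2 by (simp add: D_def)
    next
      case 3
      then have "f (w - L) \<le> f (Suc w - L)" by (intro up) auto
      then show ?thesis using 3 w \<open>f (Suc w) \<le> f w\<close> by (simp add: D_def)
    qed
    then show ?case using w by (simp add: P_def)
  qed
  then have "D w \<le> 0" if "t' \<le> w" for w using that by (simp add: P_def)
  ultimately have "peak_at (window f L) t'"
    by (intro peak_atI) (simp_all add: W)
  then show ?thesis ..
qed

text \<open>Nonnegativity is carried through the induction because \<open>window_peak\<close> needs
  it.\<close>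

lemma slice_coeff_nonneg_and_peak: "(\<forall>j. slice_coeff k j \<ge> 0) \<and> (\<exists>t. peak_at (slice_coeff k) t)"
proof (induction k)
  case 0
  have "slice_coeff 0 j = (if j \<le> 1 then 1 else 0)" for j
    by (auto simp: slice_coeff_def slice_0_0)
  then show ?case
    by (auto simp: peak_at_def intro!: exI [of _ 1])
next
  case (Suc k)
  \<comment> \<open>\<open>r\<close> sends \<open>(k + 2) n + s\<close> to
    \<open>(k + 1) n + s\<close>, so it takes the same value at the end of a block and at the start
    of the next.\<close>
  define r where "r j = Suc k * (j div Suc (Suc k)) + j mod Suc (Suc k)" for j
  define W where "W = window (slice_coeff k) (2 * Suc k)"
  have aW: "slice_coeff (Suc k) = (\<lambda>j. W (r j))"
  proof
    fix j
    have "j mod Suc (Suc k) \<le> Suc k"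
      using mod_less_divisor [of "Suc (Suc k)" j] by linarith
    then show "slice_coeff (Suc k) j = W (r j)"
      using slice_coeff_Suc_eq_window [of "j mod Suc (Suc k)" k "j div Suc (Suc k)"]
      by (simp only: mult_div_mod_eq r_def W_def)
  qed
  have "W w \<ge> 0" for w
    unfolding W_def window_def using Suc by (intro sum_nonneg) auto
  moreover obtain t where t: "peak_at W t"
    using Suc window_peak unfolding W_def by blast
  have "mono r"
    unfolding mono_iff_le_Suc
  proof
    fix j show "r j \<le> r (Suc j)"
      by (auto simp: r_def div_Suc mod_Suc)
  qed
  \<comment> \<open>A preimage of the peak \<open>t\<close>: the quotient and remainder of
    \<open>t\<close> modulo \<open>k + 1\<close>, reassembled with block length
    \<open>k + 2\<close>.\<close>
  moreover have "r (Suc (Suc k) * (t div Suc k) + t mod Suc k) = t"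
  proof -
    have "t mod Suc k < Suc (Suc k)" using mod_less_divisor [of "Suc k" t] by linarith
    then show ?thesis by (simp add: r_def del: mult_Suc)
  qed
  ultimately show ?case
    unfolding aW using peak_at_mono_compose [OF t] by blast
qed

section \<open>From Laurent series to polynomials\<close>

abbreviation emb :: "int poly \<Rightarrow> int fls" where
  "emb p \<equiv> fps_to_fls (fps_of_poly p)"

lemma emb_simps:
  "emb (p + q) = emb p + emb q" "emb (p - q) = emb p - emb q" "emb (p * q) = emb p * emb q"
  "emb (p ^ n) = emb p ^ n" "emb (of_nat n) = of_nat n" "emb 1 = 1"
  by (simp_all add: fps_of_poly_add fps_of_poly_diff fps_of_poly_mult fps_of_poly_power
      fls_times_fps_to_fls fps_to_fls_power of_nat_poly fps_of_poly_const fps_of_nat)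

lemma emb_sum: "emb (sum f S) = (\<Sum>x\<in>S. emb (f x))"
  by (induction S rule: infinite_finite_induct) (simp_all add: emb_simps)

lemma fls_X_intpow_eq_emb: "fls_X_intpow (int n) = emb (monom 1 n)"
  by (simp add: fps_of_poly_monom' fps_to_fls_power fls_X_power_conv_shift_1)

lemma BEuler_at_eq_emb: "BEuler_at n (int M) = emb (pcompose (Bpoly n) (monom 1 M))"
proof -
  have "pcompose (monom 1 d) (monom 1 M) = monom (1::int) (M * d)" for d
    by (simp add: pcompose_monom_1 monom_power)
  then show ?thesis
    unfolding BEuler_at_def Bpoly_def pcompose_sum emb_sum
    by (simp flip: fls_X_intpow_eq_emb)
qed

text \<open>Negating permutations sends \<open>d\<close> descents to \<open>n - d\<close>, that is
  \<open>B_n(1/y) = y^(-n) B_n(y)\<close>.\<close>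

lemma BEuler_at_uminus: "BEuler_at n (- e) = fls_X_intpow (- e * int n) * BEuler_at n e"
proof -
  have "BEuler_at n (- e) = (\<Sum>\<pi>\<in>signed_perms n. fls_X_intpow (- e * int (desB n (\<lambda>i. - \<pi> i))))"
    unfolding BEuler_at_def
    by (rule sum.reindex_bij_witness [of _ "\<lambda>\<pi> i. - \<pi> i" "\<lambda>\<pi> i. - \<pi> i"])
      (auto simp: uminus_in_signed_perms)
  also have "\<dots> = (\<Sum>\<pi>\<in>signed_perms n. fls_X_intpow (- e * int n) * fls_X_intpow (e * int (desB n \<pi>)))"
  proof (intro sum.cong refl)
    fix \<pi> assume "\<pi> \<in> signed_perms n"
    then have "int (desB n (\<lambda>i. - \<pi> i)) = int n - int (desB n \<pi>)"
      using desB_uminus by fastforce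
    then have "- e * int (desB n (\<lambda>i. - \<pi> i)) = - e * int n + e * int (desB n \<pi>)"
      by (simp only: right_diff_distrib minus_mult_left [symmetric])
    then show "fls_X_intpow (- e * int (desB n (\<lambda>i. - \<pi> i)))
        = fls_X_intpow (- e * int n) * (fls_X_intpow (e * int (desB n \<pi>)) :: int fls)"
      by (simp only: fls_X_intpow_times_fls_X_intpow)
  qed
  finally show ?thesis
    by (simp add: BEuler_at_def sum_distrib_left)
qed

text \<open>With \<open>c = y - 1\<close> this is the shape of the first sum in \<open>H\<^sub>k\<close>; palindromicity of \<open>B\<^sub>n\<close>
  brings the second sum to the same shape with \<open>c = 1 - y\<close>.\<close>

lemma sum_swap_B_twist:
  "(\<Sum>l=0..k. pcompose (Bpoly (k - l)) q * pcompose c q ^ l * (\<Sum>s=l..k. of_nat (s choose l) * f s))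
    = (\<Sum>s\<le>k. f s * pcompose (B_twist c k s) q)"
proof -
  have "(\<Sum>s=l..k. of_nat (s choose l) * f s) = (\<Sum>s\<le>k. of_nat (s choose l) * f s)" for l
    by (intro sum.mono_neutral_left) auto
  then have "(\<Sum>l=0..k. pcompose (Bpoly (k - l)) q * pcompose c q ^ l * (\<Sum>s=l..k. of_nat (s choose l) * f s))
     = (\<Sum>l\<le>k. \<Sum>s\<le>k. pcompose (Bpoly (k - l)) q * pcompose c q ^ l * (of_nat (s choose l) * f s))"
    by (simp add: sum_distrib_left atLeast0AtMost)
  also have "\<dots> = (\<Sum>s\<le>k. \<Sum>l\<le>k. f s * (of_nat (s choose l) * pcompose (Bpoly (k - l)) q * pcompose c q ^ l))"
    by (subst sum.swap) (simp only: mult_ac)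
  also have "\<dots> = (\<Sum>s\<le>k. f s * pcompose (B_twist c k s) q)"
    by (simp add: B_twist_def pcompose_sum pcompose_mult pcompose_power pcompose_of_nat sum_distrib_left)
  finally show ?thesis .
qed

text \<open>With \<open>y = x^(k+1)\<close>, the \<open>y^2\<close> inside \<open>slice\<close>
  becomes the argument \<open>x^(2k+2)\<close> of the Eulerian polynomials in
  \<open>H\<close>.\<close>

definition H_poly :: "nat \<Rightarrow> int poly" where
  "H_poly k = (\<Sum>s\<le>k. monom 1 (Suc k + s) * pcompose (slice k s) (monom 1 (Suc k)))"

lemma H_eq_emb: "H k = emb (H_poly k)"
proof -
  define Y :: "int poly" where "Y = monom 1 (2 * Suc k)"
  have Y: "2 * int k + 2 = int (2 * Suc k)" "- 2 * int k - 2 = - int (2 * Suc k)" by simp_all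
  have XY: "fls_X_intpow (int (2 * Suc k)) = emb Y"
    unfolding Y_def by (rule fls_X_intpow_eq_emb)
  have lin: "Y - 1 = pcompose [:-1, 1:] Y" "1 - Y = pcompose [:1, -1:] Y"
    by (simp_all add: pcompose_pCons one_pCons)
  have "(\<Sum>l=0..k. BEuler_at (k - l) (2*int k + 2) * (fls_X_intpow (2*int k + 2) - 1) ^ l *
            (\<Sum>s=l..k. of_nat (s choose l) * fls_X_intpow (2*int k + 1 - int s)))
      = emb (\<Sum>l=0..k. pcompose (Bpoly (k - l)) Y * pcompose [:-1, 1:] Y ^ l *
          (\<Sum>s=l..k. of_nat (s choose l) * monom 1 (2 * k + 1 - s)))"
    unfolding emb_sum Y XY BEuler_at_eq_emb
  proof (intro sum.cong refl)
    fix l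
    have "(\<Sum>s=l..k. of_nat (s choose l) * fls_X_intpow (2*int k + 1 - int s))
        = emb (\<Sum>s=l..k. of_nat (s choose l) * monom 1 (2 * k + 1 - s))"
      unfolding emb_sum
    proof (intro sum.cong refl)
      fix s assume "s \<in> {l..k}"
      then have "2 * int k + 1 - int s = int (2 * k + 1 - s)" by (simp add: of_nat_diff)
      then show "of_nat (s choose l) * fls_X_intpow (2*int k + 1 - int s)
          = emb (of_nat (s choose l) * monom 1 (2 * k + 1 - s))"
        by (simp only: fls_X_intpow_eq_emb emb_simps)
    qed
    then show "emb (pcompose (Bpoly (k - l)) (monom 1 (2 * Suc k))) * (emb Y - 1) ^ l *
          (\<Sum>s=l..k. of_nat (s choose l) * fls_X_intpow (2*int k + 1 - int s))
        = emb (pcompose (Bpoly (k - l)) Y * pcompose [:-1, 1:] Y ^ l *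
          (\<Sum>s=l..k. of_nat (s choose l) * monom 1 (2 * k + 1 - s)))"
      by (simp only: emb_simps lin [symmetric] Y_def [symmetric])
  qed
  also have "\<dots> = emb (\<Sum>s\<le>k. monom 1 (2 * k + 1 - s) * pcompose (B_twist [:-1, 1:] k s) Y)"
    by (simp only: sum_swap_B_twist)
  \<comment> \<open>Reversing \<open>s\<close> makes the exponents increase; this is why
    \<open>slice\<close> uses \<open>k - s\<close> in its even half.\<close>
  also have "(\<Sum>s\<le>k. monom 1 (2 * k + 1 - s) * pcompose (B_twist [:-1, 1:] k s) Y)
      = (\<Sum>s\<le>k. monom 1 (Suc k + s) * pcompose (B_twist [:-1, 1:] k (k - s)) Y)"
    by (rule sum.reindex_bij_witness [of _ "\<lambda>s. k - s" "\<lambda>s. k - s"])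
      (auto simp: mult_2 Suc_diff_le)
  finally have first: "(\<Sum>l=0..k. BEuler_at (k - l) (2*int k + 2) * (fls_X_intpow (2*int k + 2) - 1) ^ l *
            (\<Sum>s=l..k. of_nat (s choose l) * fls_X_intpow (2*int k + 1 - int s)))
      = emb (\<Sum>s\<le>k. monom 1 (Suc k + s) * pcompose (B_twist [:-1, 1:] k (k - s)) Y)" .
  have "(\<Sum>l=0..k. BEuler_at (k - l) (-2*int k - 2) * (fls_X_intpow (-2*int k - 2) - 1) ^ l *
            (\<Sum>s=l..k. of_nat (s choose l) * fls_X_intpow (2*(int k + 1)^2 + int s)))
      = emb (\<Sum>l=0..k. pcompose (Bpoly (k - l)) Y * pcompose [:1, -1:] Y ^ l *
          (\<Sum>s=l..k. of_nat (s choose l) * monom 1 (2 * Suc k + s)))"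
    unfolding emb_sum Y
  proof (intro sum.cong refl)
    fix l assume l: "l \<in> {0..k}"
    let ?M = "int (2 * Suc k)"
    \<comment> \<open>\<open>1/y - 1 = (1 - y)/y\<close> turns the twist by \<open>1/y - 1\<close>
      into one by \<open>1 - y\<close>.\<close>
    have "fls_X_intpow (- ?M) - 1 = fls_X_intpow (- ?M) * (1 - emb Y)"
      by (simp only: XY [symmetric] right_diff_distrib fls_X_intpow_times_fls_X_intpow mult_1_right) simp
    then have pow: "(fls_X_intpow (- ?M) - 1 :: int fls) ^ l
        = fls_X_intpow (- ?M * int l) * emb (pcompose [:1, -1:] Y ^ l)"
      by (simp only: power_mult_distrib fls_X_intpow_power emb_simps lin [symmetric] mult.commute)
    have B: "BEuler_at (k - l) (- ?M) = fls_X_intpow (- ?M * int (k - l)) * emb (pcompose (Bpoly (k - l)) Y)"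
      unfolding BEuler_at_uminus BEuler_at_eq_emb Y_def ..
    \<comment> \<open>The negative powers combine to \<open>-2 (k + 1) k\<close> independently of
      \<open>l\<close>; against \<open>2 (k + 1)^2\<close> this leaves \<open>2 (k + 1)\<close>, so
      no negative exponent survives.\<close>
    have "?M * int (k - l) + ?M * int l = ?M * int k"
      using l by (simp add: of_nat_diff algebra_simps)
    then have exps: "- ?M * int (k - l) + (- ?M * int l) + (2*(int k + 1)^2 + int s) = int (2 * Suc k + s)" for s
      by (simp add: power2_eq_square algebra_simps)
    have "BEuler_at (k - l) (- ?M) * (fls_X_intpow (- ?M) - 1) ^ l *
            (\<Sum>s=l..k. of_nat (s choose l) * fls_X_intpow (2*(int k + 1)^2 + int s))
        = emb (pcompose (Bpoly (k - l)) Y * pcompose [:1, -1:] Y ^ l) *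
            (\<Sum>s=l..k. of_nat (s choose l) * (fls_X_intpow (- ?M * int (k - l)) *
              fls_X_intpow (- ?M * int l) * fls_X_intpow (2*(int k + 1)^2 + int s)))"
      unfolding pow B by (simp only: emb_simps sum_distrib_left mult_ac)
    also have "\<dots> = emb (pcompose (Bpoly (k - l)) Y * pcompose [:1, -1:] Y ^ l) *
            (\<Sum>s=l..k. of_nat (s choose l) * emb (monom 1 (2 * Suc k + s)))"
      by (simp only: fls_X_intpow_times_fls_X_intpow exps fls_X_intpow_eq_emb)
    finally show "BEuler_at (k - l) (- ?M) * (fls_X_intpow (- ?M) - 1) ^ l *
            (\<Sum>s=l..k. of_nat (s choose l) * fls_X_intpow (2*(int k + 1)^2 + int s))
        = emb (pcompose (Bpoly (k - l)) Y * pcompose [:1, -1:] Y ^ l *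
            (\<Sum>s=l..k. of_nat (s choose l) * monom 1 (2 * Suc k + s)))"
      by (simp only: emb_simps emb_sum)
  qed
  also have "\<dots> = emb (\<Sum>s\<le>k. monom 1 (2 * Suc k + s) * pcompose (B_twist [:1, -1:] k s) Y)"
    by (simp only: sum_swap_B_twist)
  finally have second: "(\<Sum>l=0..k. BEuler_at (k - l) (-2*int k - 2) * (fls_X_intpow (-2*int k - 2) - 1) ^ l *
            (\<Sum>s=l..k. of_nat (s choose l) * fls_X_intpow (2*(int k + 1)^2 + int s)))
      = emb (\<Sum>s\<le>k. monom 1 (2 * Suc k + s) * pcompose (B_twist [:1, -1:] k s) Y)" .
  have "pcompose (slice k s) (monom 1 (Suc k)) = pcompose (B_twist [:-1, 1:] k (k - s)) Y
      + monom 1 (Suc k) * pcompose (B_twist [:1, -1:] k s) Y" for s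
  proof -
    have "pcompose (monom 1 2) (monom 1 (Suc k)) = Y"
      by (simp only: Y_def pcompose_monom_1 monom_power power_one mult.commute)
    then show ?thesis
      by (simp add: slice_def pcompose_add pcompose_mult pcompose_monom_1 flip: pcompose_assoc)
  qed
  then have "H_poly k = (\<Sum>s\<le>k. monom 1 (Suc k + s) * pcompose (B_twist [:-1, 1:] k (k - s)) Y)
      + (\<Sum>s\<le>k. monom 1 (Suc k + s) * monom 1 (Suc k) * pcompose (B_twist [:1, -1:] k s) Y)"
    by (simp only: H_poly_def distrib_left sum.distrib mult.assoc)
  \<comment> \<open>The extra \<open>x^(k+1)\<close> is the factor \<open>y\<close> of the odd half
    of \<open>slice\<close>.\<close>
  moreover have "monom (1::int) (Suc k + s) * monom 1 (Suc k) = monom 1 (2 * Suc k + s)" for s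
    by (simp add: mult_monom mult_2 add_ac)
  ultimately show ?thesis
    unfolding H_def first second by (simp only: emb_simps)
qed

section \<open>Coefficients of the polynomial and conclusion\<close>

text \<open>The slices sit in distinct residue classes of exponents modulo \<open>k + 1\<close>, so
  they never overlap: only \<open>s = i mod Suc k\<close> contributes at exponent
  \<open>Suc k + i\<close>.\<close>

lemma coeff_H_poly: "coeff (H_poly k) j = (if j < Suc k then 0 else slice_coeff k (j - Suc k))"
proof (cases "j < Suc k")
  case True
  then show ?thesis by (simp add: H_poly_def coeff_sum coeff_monom_mult)
next
  case False
  then obtain i where j: "j = Suc k + i" using le_Suc_ex not_less by blast
  have "coeff (H_poly k) j = (\<Sum>s\<le>k. if s = i mod Suc k then coeff (slice k s) (i div Suc k) else 0)"
    unfolding H_poly_def coeff_sum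
  proof (intro sum.cong refl)
    fix s assume "s \<in> {..k}"
    then have s: "s < Suc k" by simp
    have c: "coeff (monom 1 (Suc k + s) * pcompose (slice k s) (monom 1 (Suc k))) j
        = (if s \<le> i \<and> Suc k dvd i - s then coeff (slice k s) ((i - s) div Suc k) else 0)"
      by (auto simp add: j coeff_monom_mult coeff_pcompose_monom not_le)
    show "coeff (monom 1 (Suc k + s) * pcompose (slice k s) (monom 1 (Suc k))) j
        = (if s = i mod Suc k then coeff (slice k s) (i div Suc k) else 0)"
    proof (cases "s = i mod Suc k")
      case True
      then have "s \<le> i" "i - s = i div Suc k * Suc k"
        by (simp_all only: mod_less_eq_dividend minus_mod_eq_div_mult)
      then show ?thesis unfolding c using True by (simp del: mult_Suc_right)
    next
      case False
      have "\<not> (s \<le> i \<and> Suc k dvd i - s)"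
      proof
        assume "s \<le> i \<and> Suc k dvd i - s"
        then have "i mod Suc k = s mod Suc k"
          by (simp add: mod_eq_dvd_iff_nat)
        then show False using False s by simp
      qed
      then show ?thesis unfolding c using False by auto
    qed
  qed
  also have "\<dots> = slice_coeff k i"
    by (simp add: slice_coeff_def sum.delta less_Suc_eq_le [symmetric])
  finally show ?thesis by (simp add: j)
qed

theorem theorem3p4:
  fixes k :: nat
  shows "\<exists>p :: int poly. H k = fps_to_fls (fps_of_poly p) \<and> unimodal (coeff_seq p)"
proof -
  obtain t where nonneg: "\<And>j. slice_coeff k j \<ge> 0" and t: "peak_at (slice_coeff k) t"
    using slice_coeff_nonneg_and_peak by blast
  \<comment> \<open>The leading zeros only prolong the rise, as all coefficients are
    nonnegative.\<close>
  have "peak_at (coeff (H_poly k)) (Suc k + t)"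
  proof (rule peak_atI)
    fix i assume "i < Suc k + t"
    then show "coeff (H_poly k) i \<le> coeff (H_poly k) (Suc i)"
      using t nonneg by (auto simp: coeff_H_poly peak_at_def)
  next
    fix i assume "Suc k + t \<le> i"
    then show "coeff (H_poly k) (Suc i) \<le> coeff (H_poly k) i"
      using t by (auto simp: coeff_H_poly peak_at_def)
  qed
  \<comment> \<open>Cutting off at the degree is harmless: a prefix inherits the inequalities with
    the same peak index, even if that index lies beyond its end.\<close>
  then have "unimodal (coeff_seq (H_poly k))"
    unfolding unimodal_def coeff_seq_def peak_at_def
    by (intro exI [of _ "Suc k + t"]) (simp del: upt_Suc)
  then show ?thesis using H_eq_emb by blast
qed

end
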